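(* Let $n\ge 2$ be an integer with square-free part $n_0$, and let $L_{Q(n)}$ and $L_{Q(n_0)}$ be the symmetric matrices associated with the Laplacians of $\mathcal{E}_n$ and $\mathcal{E}_{n_0}$, respectively. Then $$L_{Q(n)}=\frac{n}{n_0}\,L_{Q(n_0)}.$$
   Context: Let $p_1<\dots<p_r$ be the distinct primes dividing $n$ and $n_0=p_1\cdots p_r$ (called the square-free part of $n$). The divisors of $n_0$ are ordered as $(d_1,\dots,d_{2^r})$ recursively: for $r=1$ the order is $(1,p_1)$, and for $r$ primes the first $2^{r-1}$ entries are those for the primes $p_1,\dots,p_{r-1}$, the remaining $2^{r-1}$ entries being obtained by multiplying each of these, in order, by $p_r$. In particular $d_1=1$, $d_{2^r}=n_0$. For a divisor $d$ of $n_0$, $[d]=\{a\in\{0,1,\dots,n-1\}:\gcd(a,n_0)=d\}$ (with $\gcd(0,n_0)=n_0$), and $a_i=|[d_{i+1}]|$ for $1\le i\le 2^r-1$. The generating graph $\mathcal{E}_n$ of $\mathbb{Z}_n=\{0,\dots,n-1\}$ is the simple graph on $\mathbb{Z}_n$ in which distinct $a,b$ are adjacent iff $\langle a,b\rangle=\mathbb{Z}_n$ (iff $\gcd(a,b,n)=1$). All vertices in a class $[d_i]$ have the same degree in $\mathcal{E}_n$, denoted $\deg(d_i)$. $\varphi$ is Euler's totient function. $L_{Q(n)}$ is the symmetric real $2^r\times 2^r$ matrix with diagonal $(n-\varphi(n),\deg(d_2),\dots,\deg(d_{2^r-1}),\varphi(n))$ and off-diagonal entries $-\rho_{i,j}$,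 where $\rho_{1,j}=\rho_{j,1}=\sqrt{\varphi(n)a_{j-1}}$ for $j\ge2$, and for $i\ne j$, $i,j\ge 2$, $\rho_{i,j}=\sqrt{a_{i-1}a_{j-1}}$ if $\gcd(d_i,d_j)=1$ and $\rho_{i,j}=0$ otherwise. $L_{Q(n_0)}$ is the same construction with $n_0$ in place of $n$ (same ordering of divisors, classes and degrees taken in $\mathbb{Z}_{n_0}$ and $\mathcal{E}_{n_0}$). *)

theory Defs
  imports
    "HOL-Number_Theory.Totient"
    "HOL-Algebra.Elementary_Groups"
    "Jordan_Normal_Form.Matrix"
begin

definition gen_adj :: "nat \<Rightarrow> int \<Rightarrow> int \<Rightarrow> bool" where
  "gen_adj n a b \<longleftrightarrow>
     a \<in> carrier (integer_mod_group n) \<and> b \<in> carrier (integer_mod_group n) \<and> a \<noteq> b \<and>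
     generate (integer_mod_group n) {a, b} = carrier (integer_mod_group n)"

definition gen_degree :: "nat \<Rightarrow> int \<Rightarrow> nat" where
  "gen_degree n a = card {b. gen_adj n a b}"

text \<open>The product of the distinct primes dividing \<open>n\<close>. This is not the library's
  \<open>squarefree_part\<close>, which keeps only the primes of odd multiplicity.\<close>

definition radical :: "nat \<Rightarrow> nat" where
  "radical n = \<Prod>(prime_factors n)"

text \<open>
  The ordered divisors of \<open>p\<^sub>1 \<cdots> p\<^sub>r\<close>: each further prime appends a multiplied copy of the
  list so far. Starting from \<open>[1]\<close> yields \<open>[1, p\<^sub>1]\<close> for one prime.
\<close>

definition ordered_divisors :: "nat list \<Rightarrow> nat list" where
  "ordered_divisors ps = foldl (\<lambda>ds p. ds @ map (\<lambda>d. d * p) ds) [1] ps"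

text \<open>\<open>divisor n i\<close> is \<open>d\<^bsub>i+1\<^esub>\<close>: indices are shifted to start at 0.\<close>

definition divisor :: "nat \<Rightarrow> nat \<Rightarrow> nat" where
  "divisor n i = ordered_divisors (sorted_list_of_set (prime_factors n)) ! i"

definition divisor_class :: "nat \<Rightarrow> nat \<Rightarrow> int set" where
  "divisor_class n d = {a \<in> carrier (integer_mod_group n). gcd a (int (radical n)) = int d}"

text \<open>With indices starting at 0, \<open>class_size n i\<close> is \<open>a\<^sub>i = |[d\<^bsub>i+1\<^esub>]|\<close> for \<open>i \<ge> 1\<close>.\<close>

definition class_size :: "nat \<Rightarrow> nat \<Rightarrow> nat" where
  "class_size n i = card (divisor_class n (divisor n i))"

text \<open>The common degree of all vertices in the (nonempty) class of \<open>d\<close>.\<close>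

definition class_degree :: "nat \<Rightarrow> nat \<Rightarrow> nat" where
  "class_degree n d = (THE k. \<forall>a \<in> divisor_class n d. gen_degree n a = k)"

definition rho :: "nat \<Rightarrow> nat \<Rightarrow> nat \<Rightarrow> real" where
  "rho n i j =
     (if i = 0 then sqrt (real (totient n) * real (class_size n j))
      else if j = 0 then sqrt (real (totient n) * real (class_size n i))
      else if gcd (divisor n i) (divisor n j) = 1
        then sqrt (real (class_size n i) * real (class_size n j))
      else 0)"

text \<open>The first diagonal entry is \<open>n - \<phi>(n)\<close>, not the degree \<open>n - 1\<close> of the vertices in class \<open>[1]\<close>.\<close>

definition LQ :: "nat \<Rightarrow> real mat" where
  "LQ n =
     (let N = 2 ^ card (prime_factors n) in
      mat N N (\<lambda>(i, j).
        if i = j then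
          (if i = 0 then real n - real (totient n)
           else if i = N - 1 then real (totient n)
           else real (class_degree n (divisor n i)))
        else - rho n i j))"

end

theory Submission
  imports Defs
begin

text \<open>
  Two residues generate \<open>\<int>\<^sub>n\<close> iff no prime factor of \<open>n\<close> divides both, so membership in a
  class and adjacency to a class both depend only on residues modulo the radical \<open>n\<^sub>0\<close>. An
  \<open>n\<^sub>0\<close>-periodic condition holds \<open>n / n\<^sub>0\<close> times as often in \<open>{0..<n}\<close> as in \<open>{0..<n\<^sub>0}\<close>;
  hence class sizes, class degrees and the totient all scale by \<open>n / n\<^sub>0\<close>, and each
  \<open>rho\<close> is a geometric mean of two such quantities.
\<close>

section \<open>The radical and coprimality to it\<close>

lemma radical_pos: "radical n > 0"
  unfolding radical_def by (rule prod_pos) (auto simp: in_prime_factors_iff intro: prime_gt_0_nat)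

lemma radical_dvd:
  assumes "n > 0"
  shows "radical n dvd n"
proof -
  have "radical n dvd (\<Prod>p\<in>prime_factors n. p ^ multiplicity p n)"
    unfolding radical_def
    by (intro prod_dvd_prod dvd_power) (auto simp: prime_factors_multiplicity)
  then show ?thesis using assms prime_factorization_nat by metis
qed

text \<open>A prime dividing a product of primes is one of its factors. Hence \<open>LQ n\<close>
  and \<open>LQ (radical n)\<close> have the same dimension and are indexed by the same
  divisors.\<close>

lemma prime_factors_radical: "prime_factors (radical n) = prime_factors n"
proof -
  have "p \<in> prime_factors n" if "prime p" "p dvd radical n" for p
  proof -
    from that obtain q where "q \<in> prime_factors n" "p dvd q"
      unfolding radical_def by (metis finite_set_mset prime_dvd_prod_iff)
    then show ?thesis
      using that(1) by (metis in_prime_factors_iff primes_dvd_imp_eq)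
  qed
  moreover have "p dvd radical n" if "p \<in> prime_factors n" for p
    unfolding radical_def using that by (intro dvd_prodI) auto
  ultimately show ?thesis
    using radical_pos[of n] by (auto simp: in_prime_factors_iff)
qed

lemma radical_radical: "radical (radical n) = radical n"
  by (subst (1) radical_def) (simp add: prime_factors_radical, simp add: radical_def)

text \<open>A prime common to \<open>x\<close> and \<open>n\<close> already divides the radical;
  conversely the radical divides \<open>n\<close>.\<close>

lemma coprime_radical_iff:
  fixes x :: int
  assumes "n > 0"
  shows "coprime x (int (radical n)) \<longleftrightarrow> coprime x (int n)"
proof -
  have "coprime (nat \<bar>x\<bar>) n" if "coprime (nat \<bar>x\<bar>) (radical n)"
  proof (rule ccontr)
    assume "\<not> coprime (nat \<bar>x\<bar>) n"
    then obtain p where p: "prime p" "p dvd nat \<bar>x\<bar>" "p dvd n"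
      by (meson coprime_iff_gcd_eq_1 gcd_dvd1 gcd_dvd2 dvd_trans prime_factor_nat)
    then have "p \<in> prime_factors (radical n)"
      using assms by (simp add: prime_factors_radical in_prime_factors_iff)
    then have "p dvd radical n" by (rule in_prime_factors_imp_dvd)
    then have "is_unit p" using p(2) that by (blast intro: coprime_common_divisor)
    then show False using p(1) by simp
  qed
  moreover have "coprime (nat \<bar>x\<bar>) (radical n)" if "coprime (nat \<bar>x\<bar>) n"
    using that by (rule coprime_divisors[OF dvd_refl radical_dvd[OF assms]])
  moreover have "coprime x (int m) \<longleftrightarrow> coprime (nat \<bar>x\<bar>) m" for m
    using coprime_int_iff[of "nat \<bar>x\<bar>" m] by simp
  ultimately show ?thesis by blast
qed

section \<open>Counting solutions of periodic conditions\<close>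

text \<open>The interval of length \<open>k * m\<close> consists of \<open>k\<close> translates of
  \<open>{0..<int m}\<close>; the induction splits off the last one.\<close>

lemma card_periodic:
  fixes P :: "int \<Rightarrow> bool"
  assumes periodic: "\<And>a. P (a + int m) \<longleftrightarrow> P a"
  shows "card {a \<in> {0..<int (k * m)}. P a} = k * card {a \<in> {0..<int m}. P a}"
proof (induction k)
  case 0
  then show ?case by simp
next
  case (Suc k)
  have shift: "P (a + int (j * m)) \<longleftrightarrow> P a" for a j
  proof (induction j)
    case (Suc j)
    have "a + int (Suc j * m) = (a + int (j * m)) + int m" by (simp add: algebra_simps)
    then show ?case using Suc.IH periodic by metis
  qed simp
  let ?S = "{a \<in> {0..<int m}. P a}"
  have "{a \<in> {0..<int (Suc k * m)}. P a} =
      {a \<in> {0..<int (k * m)}. P a} \<union> (\<lambda>a. a + int (k * m)) ` ?S" (is "_ = ?A \<union> ?B")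
  proof (rule Set.set_eqI, rule iffI)
    fix a assume a: "a \<in> {a \<in> {0..<int (Suc k * m)}. P a}"
    show "a \<in> ?A \<union> ?B"
    proof (cases "a < int (k * m)")
      case False
      then have "a - int (k * m) \<in> ?S"
        using a shift[of "a - int (k * m)" k] by (auto simp: algebra_simps)
      then show ?thesis by (intro UnI2 image_eqI[where x = "a - int (k * m)"]) simp_all
    qed (use a in auto)
  next
    fix a assume "a \<in> ?A \<union> ?B"
    then show "a \<in> {a \<in> {0..<int (Suc k * m)}. P a}"
      using shift[of _ k] by (auto simp: algebra_simps)
  qed
  moreover have "?A \<inter> ?B = {}" by auto
  moreover have "finite {a \<in> {0..<int j}. P a}" for j
    by (rule finite_subset[of _ "{0..<int j}"]) auto
  ultimately have "card {a \<in> {0..<int (Suc k * m)}. P a} = card ?A + card ?B"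
    by (simp only: card_Un_disjoint finite_imageI)
  also have "card ?B = card ?S" by (intro card_image) (auto simp: inj_on_def)
  finally show ?case using Suc.IH by simp
qed

section \<open>Generating pairs of residues\<close>

text \<open>Multiples of \<open>gcd (gcd a b) (int n)\<close> are preserved by reduction modulo
  \<open>n\<close>, so they are closed under the group operations. The converse is Bezout's
  identity.\<close>

lemma generate_integer_mod_group_iff:
  assumes "n \<ge> 2" "a \<in> carrier (integer_mod_group n)" "b \<in> carrier (integer_mod_group n)"
  shows "generate (integer_mod_group n) {a, b} = carrier (integer_mod_group n)
    \<longleftrightarrow> coprime (gcd a b) (int n)"
proof -
  interpret G: group "integer_mod_group n" by simp
  let ?G = "integer_mod_group n" and ?g = "gcd (gcd a b) (int n)"
  have carrier: "carrier ?G = {0..<int n}"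
    using assms(1) by (simp add: carrier_integer_mod_group)
  have sub: "subgroup (generate ?G {a, b}) ?G"
    using assms by (intro G.generate_is_subgroup) auto
  have mod_dvd: "?g dvd x mod int n" if "?g dvd x" for x
    using that by (simp add: dvd_mod)
  show ?thesis
  proof
    assume eq: "generate ?G {a, b} = carrier ?G"
    have "?g dvd x" if "x \<in> generate ?G {a, b}" for x
      using that
    proof (induction rule: generate.induct)
      case one
      then show ?case by simp
    next
      case (incl h)
      then show ?case by (auto intro: dvd_trans[OF gcd_dvd1])
    next
      case (inv h)
      then have "h \<in> carrier ?G" "?g dvd h" using assms by (auto intro: dvd_trans[OF gcd_dvd1])
      then show ?case using mod_dvd[of "-h"] by (simp add: inv_integer_mod_group)
    next
      case (eng h1 h2)
      then show ?case using mod_dvd[of "h1 + h2"] by simp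
    qed
    \<comment> \<open>The residue 1 forces \<open>?g\<close> to be a unit; it lies in the carrier
      because \<open>n \<ge> 2\<close>.\<close>
    moreover have "1 \<in> carrier ?G" using assms(1) carrier by simp
    ultimately have "?g dvd 1" using eq by blast
    then show "coprime (gcd a b) (int n)" by (simp add: coprime_iff_gcd_eq_1)
  next
    assume "coprime (gcd a b) (int n)"
    moreover obtain u v where "u * a + v * b = gcd a b" using bezout_int by blast
    moreover obtain s t where "s * gcd a b + t * int n = gcd (gcd a b) (int n)"
      using bezout_int by blast
    ultimately have one: "s * (u * a + v * b) + t * int n = 1" by simp
    have "c \<in> generate ?G {a, b}" if c: "c \<in> carrier ?G" for c
    proof -
      have pow: "x [^]\<^bsub>?G\<^esub> (k::int) \<in> generate ?G {a, b}" if "x \<in> {a, b}" for x k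
        using that sub by (intro G.subgroup_int_pow_closed generate.incl)
      \<comment> \<open>The exponents are the Bezout coefficients in \<open>one\<close> multiplied
        by \<open>c\<close>: the group is additive, so powers are multiples.\<close>
      have "(a [^]\<^bsub>?G\<^esub> (c * s * u)) \<otimes>\<^bsub>?G\<^esub> (b [^]\<^bsub>?G\<^esub> (c * s * v)) \<in> generate ?G {a, b}"
        by (intro generate.eng pow) auto
      also have "(a [^]\<^bsub>?G\<^esub> (c * s * u)) \<otimes>\<^bsub>?G\<^esub> (b [^]\<^bsub>?G\<^esub> (c * s * v))
          = (c * (s * (u * a + v * b))) mod int n"
        by (simp add: int_pow_integer_mod_group algebra_simps mod_simps)
      also have "s * (u * a + v * b) = 1 - t * int n" using one by simp
      also have "c * (1 - t * int n) mod int n = c mod int n"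
        by (metis right_diff_distrib mult.assoc mult.right_neutral mod_diff_right_eq mod_mult_self2_is_0 diff_zero)
      also have "\<dots> = c" using c carrier by simp
      finally show ?thesis .
    qed
    then show "generate ?G {a, b} = carrier ?G"
      using G.generate_incl[of "{a, b}"] assms by auto
  qed
qed

section \<open>The ordered list of divisors\<close>

lemma ordered_divisors_snoc:
  "ordered_divisors (ps @ [p]) = ordered_divisors ps @ map (\<lambda>d. d * p) (ordered_divisors ps)"
  by (simp add: ordered_divisors_def)

lemma length_ordered_divisors: "length (ordered_divisors ps) = 2 ^ length ps"
  by (induction ps rule: rev_induct) (simp add: ordered_divisors_def, simp add: ordered_divisors_snoc)

lemma ordered_divisors_dvd: "d \<in> set (ordered_divisors ps) \<Longrightarrow> d dvd prod_list ps"
  by (induction ps arbitrary: d rule: rev_induct)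
     (simp add: ordered_divisors_def, auto simp: ordered_divisors_snoc intro: mult_dvd_mono)

text \<open>Entries in the appended half carry the factor \<open>p\<close>, and those before it are
  covered by induction.\<close>

lemma ordered_divisors_neq_1:
  assumes "\<forall>p \<in> set ps. prime p" "0 < i" "i < length (ordered_divisors ps)"
  shows "ordered_divisors ps ! i \<noteq> 1"
  using assms
proof (induction ps arbitrary: i rule: rev_induct)
  case Nil
  then show ?case by (simp add: ordered_divisors_def)
next
  case (snoc p ps)
  then show ?case by (auto simp: ordered_divisors_snoc nth_append)
qed

lemma divisor_dvd_radical:
  assumes "i < 2 ^ card (prime_factors n)"
  shows "divisor n i dvd radical n"
proof -
  have "divisor n i \<in> set (ordered_divisors (sorted_list_of_set (prime_factors n)))"
    unfolding divisor_def using assms by (intro nth_mem) (simp add: length_ordered_divisors)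
  then have "divisor n i dvd prod_list (sorted_list_of_set (prime_factors n))"
    by (rule ordered_divisors_dvd)
  then show ?thesis
    using prod.distinct_set_conv_list[of "sorted_list_of_set (prime_factors n)" "\<lambda>p. p"]
    by (simp add: radical_def)
qed

lemma divisor_neq_1:
  assumes "0 < i" "i < 2 ^ card (prime_factors n)"
  shows "divisor n i \<noteq> 1"
  unfolding divisor_def using assms
  by (intro ordered_divisors_neq_1) (auto simp: length_ordered_divisors)

section \<open>Degrees in the generating graph\<close>

lemma class_degree_eq:
  assumes "n \<ge> 2" "d dvd radical n" "d \<noteq> 1"
  shows "class_degree n d = card {b \<in> {0..<int n}. coprime b (int d)}"
proof -
  have carrier: "carrier (integer_mod_group n) = {0..<int n}"
    using assms(1) by (simp add: carrier_integer_mod_group)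
  have degree: "gen_degree n a = card {b \<in> {0..<int n}. coprime b (int d)}"
    if a: "a \<in> divisor_class n d" for a
  proof -
    have acar: "a \<in> carrier (integer_mod_group n)" and agcd: "gcd a (int (radical n)) = int d"
      using a by (auto simp: divisor_class_def)
    have "coprime (gcd a b) (int n) \<longleftrightarrow> coprime b (int d)" for b
    proof -
      have "coprime (gcd a b) (int n) \<longleftrightarrow> coprime (gcd a b) (int (radical n))"
        using assms(1) by (simp add: coprime_radical_iff)
      \<comment> \<open>Regrouping the triple gcd brings \<open>a\<close> and the radical together,
        and their gcd is \<open>d\<close>.\<close>
      also have "\<dots> \<longleftrightarrow> coprime b (int d)"
        unfolding coprime_iff_gcd_eq_1 agcd[symmetric] by (simp add: ac_simps)
      finally show ?thesis .
    qed
    \<comment> \<open>The counted set therefore omits \<open>a\<close> itself, in agreement with the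
      absence of loops. For \<open>d = 1\<close> the count would be one too large.\<close>
    moreover have "\<not> coprime a (int d)"
      using assms(3) agcd by (metis coprime_common_divisor dvd_refl gcd_dvd1 nat_dvd_1_iff_1 int_dvd_int_iff of_nat_1)
    ultimately have "{b. gen_adj n a b} = {b \<in> {0..<int n}. coprime b (int d)}"
      using acar generate_integer_mod_group_iff[OF assms(1) acar]
      unfolding gen_adj_def carrier by auto
    then show ?thesis by (simp add: gen_degree_def)
  qed
  have "d \<le> n"
    using assms radical_dvd[of n] by (intro dvd_imp_le) (auto intro: dvd_trans)
  \<comment> \<open>Without a witness, the description defining \<open>class_degree\<close> would be unspecified.\<close>
  have "\<exists>a. a \<in> divisor_class n d"
  proof (cases "d = n")
    case True
    \<comment> \<open>Here \<open>d\<close> exceeds the range of residues, so 0 represents its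
      class.\<close>
    then have "radical n = n" using assms radical_dvd[of n] by (simp add: dvd_antisym)
    then have "0 \<in> divisor_class n d" using True assms by (simp add: divisor_class_def carrier)
    then show ?thesis ..
  next
    case False
    then have "int d \<in> divisor_class n d"
      using \<open>d \<le> n\<close> assms(2) by (simp add: divisor_class_def carrier gcd_proj1_iff)
    then show ?thesis ..
  qed
  then show ?thesis
    unfolding class_degree_def using degree by (intro the_equality) auto
qed

section \<open>Scaling by the ratio of \<open>n\<close> to its radical\<close>

lemma divisor_radical: "divisor (radical n) i = divisor n i"
  by (simp add: divisor_def prime_factors_radical)

lemma card_periodic_radical:
  fixes P :: "int \<Rightarrow> bool"
  assumes "n > 0" "\<And>a. P (a + int (radical n)) \<longleftrightarrow> P a"
  shows "real (card {a \<in> {0..<int n}. P a})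
    = real n / real (radical n) * real (card {a \<in> {0..<int (radical n)}. P a})"
proof -
  obtain k where k: "n = k * radical n"
    using radical_dvd[OF assms(1)] by (metis dvd_def mult.commute)
  have "card {a \<in> {0..<int (k * radical n)}. P a} = k * card {a \<in> {0..<int (radical n)}. P a}"
    by (rule card_periodic) (rule assms(2))
  moreover have "real n / real (radical n) = real k"
    using radical_pos[of n] by (subst k) simp
  ultimately show ?thesis using k by simp
qed

lemma class_size_radical:
  assumes "n > 0"
  shows "real (class_size n i) = real n / real (radical n) * real (class_size (radical n) i)"
proof -
  have "divisor_class m d = {a \<in> {0..<int m}. gcd a (int (radical m)) = int d}" if "m > 0" for m d
    using that by (simp add: divisor_class_def carrier_integer_mod_group)
  then show ?thesis
    using card_periodic_radical[of n "\<lambda>a. gcd a (int (radical n)) = int (divisor n i)"]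
      assms radical_pos[of n]
    by (simp add: class_size_def divisor_radical radical_radical)
qed

text \<open>Since \<open>d\<close> divides the radical, coprimality to \<open>d\<close> is periodic
  modulo the radical.\<close>

lemma class_degree_radical:
  assumes "n \<ge> 2" "radical n \<ge> 2" "d dvd radical n" "d \<noteq> 1"
  shows "real (class_degree n d) = real n / real (radical n) * real (class_degree (radical n) d)"
proof -
  obtain c where "radical n = c * d" using assms(3) by (metis dvdE mult.commute)
  then have "coprime (a + int (radical n)) (int d) \<longleftrightarrow> coprime a (int d)" for a
    using gcd_add_mult[of "int d" "int c" a] by (simp add: coprime_iff_gcd_eq_1 ac_simps)
  then show ?thesis
    using assms card_periodic_radical[of n "\<lambda>a. coprime a (int d)"]
    by (simp add: class_degree_eq radical_radical)
qed

text \<open>In Euler's product formula the factors \<open>1 - 1/p\<close> depend only on the set of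
  primes.\<close>

lemma totient_radical:
  assumes "n > 0"
  shows "real (totient n) = real n / real (radical n) * real (totient (radical n))"
  using radical_pos[of n] assms by (simp add: totient_formula2 prime_factors_radical)

lemma rho_radical:
  assumes "n > 0"
  shows "rho n i j = real n / real (radical n) * rho (radical n) i j"
proof -
  define c where "c = real n / real (radical n)"
  have "sqrt ((c * x) * (c * y)) = c * sqrt (x * y)" for x y
  proof -
    have "(c * x) * (c * y) = c\<^sup>2 * (x * y)" by (simp add: power2_eq_square)
    \<comment> \<open>The root of \<open>c\<^sup>2\<close> is \<open>c\<close> because
      \<open>c\<close> is nonnegative.\<close>
    then show ?thesis by (simp only: real_sqrt_mult) (simp add: c_def)
  qed
  then show ?thesis
    unfolding rho_def class_size_radical[OF assms] totient_radical[OF assms] divisor_radical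
      c_def[symmetric]
    by simp
qed

theorem theorem5p0p6:
  fixes n :: nat
  assumes "n \<ge> 2"
  shows "LQ n = (real n / real (radical n)) \<cdot>\<^sub>m LQ (radical n)"
proof -
  have n: "n > 0" using assms by simp
  \<comment> \<open>Otherwise \<open>n\<close> would be coprime to itself.\<close>
  have "radical n \<noteq> 1"
    using coprime_radical_iff[OF n, of "int n"] assms by auto
  then have rad: "radical n \<ge> 2" using radical_pos[of n] by simp
  define c where "c = real n / real (radical n)"
  have c: "real n = c * real (radical n)"
    unfolding c_def using radical_pos[of n] by simp
  show ?thesis
    unfolding c_def[symmetric]
  proof (rule eq_matI, goal_cases)
    case (1 i j)
    then have ij: "i < 2 ^ card (prime_factors n)" "j < 2 ^ card (prime_factors n)"
      by (auto simp: LQ_def Let_def prime_factors_radical)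
    \<comment> \<open>This serves the middle of the diagonal; the two corner entries scale through
      \<open>n\<close> and the totient.\<close>
    have "real (class_degree n (divisor n i)) = c * real (class_degree (radical n) (divisor n i))"
      if "i \<noteq> 0"
      unfolding c_def using assms rad that ij
      by (intro class_degree_radical divisor_dvd_radical divisor_neq_1) auto
    then show ?case
      using ij c totient_radical[OF n] rho_radical[OF n, of i j]
      unfolding LQ_def Let_def prime_factors_radical divisor_radical c_def[symmetric]
      by (auto simp: algebra_simps)
  qed (auto simp: LQ_def Let_def prime_factors_radical)
qed

end
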